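(* Let $G$ be a finite group. Then $$c(\mathcal{RP}^*(G))=c(\mathcal P^*(G))+\sum_{p\mid |G|} r_p\,(p-2),$$ where the sum runs over all primes $p$ dividing $|G|$ and, for each such $p$: $r_p=0$ if $G\cong\mathbb Z_n$ with $n\ne p$; $r_p=1$ if $G\cong\mathbb Z_p$; and otherwise $r_p$ equals the number of maximal cyclic subgroups of $G$ of prime order $p$.
   Context: For a group $G$ with identity $e$, the proper power graph $\mathcal P^*(G)$ is the simple graph with vertex set $G\setminus\{e\}$ in which distinct $u,v$ are adjacent if and only if $\langle v\rangle\subseteq\langle u\rangle$ or $\langle u\rangle\subseteq\langle v\rangle$. The proper reduced power graph $\mathcal{RP}^*(G)$ is the simple graph with vertex set $G\setminus\{e\}$ in which $u,v$ are adjacent if and only if $\langle v\rangle\subset\langle u\rangle$ or $\langle u\rangle\subset\langle v\rangle$, where $\subset$ means proper inclusion. $c(\Gamma)$ denotes the number of connected components of $\Gamma$. A maximal cyclic subgroup is a cyclic subgroup not properly contained in any other cyclic subgroup of $G$. *)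

theory Defs
  imports "HOL-Algebra.Algebra" "Graph_Theory.Digraph_Component"
begin

text \<open>
  Following the Graph_Theory library, a simple graph is a symmetric loop-free digraph without
  parallel arcs; an edge between \<open>u\<close> and \<open>v\<close> is the pair of arcs \<open>(u, v)\<close>, \<open>(v, u)\<close>.
  \<open>generate G {u}\<close> is the cyclic subgroup generated by \<open>u\<close>.
\<close>

definition proper_power_graph :: "('a, 'b) monoid_scheme \<Rightarrow> 'a pair_pre_digraph" where
  "proper_power_graph G =
    \<lparr> pverts = carrier G - {\<one>\<^bsub>G\<^esub>},
      parcs = {(u, v). u \<in> carrier G - {\<one>\<^bsub>G\<^esub>} \<and> v \<in> carrier G - {\<one>\<^bsub>G\<^esub>} \<and> u \<noteq> v \<and>
        (generate G {v} \<subseteq> generate G {u} \<or> generate G {u} \<subseteq> generate G {v})} \<rparr>"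

definition proper_reduced_power_graph :: "('a, 'b) monoid_scheme \<Rightarrow> 'a pair_pre_digraph" where
  "proper_reduced_power_graph G =
    \<lparr> pverts = carrier G - {\<one>\<^bsub>G\<^esub>},
      parcs = {(u, v). u \<in> carrier G - {\<one>\<^bsub>G\<^esub>} \<and> v \<in> carrier G - {\<one>\<^bsub>G\<^esub>} \<and>
        (generate G {v} \<subset> generate G {u} \<or> generate G {u} \<subset> generate G {v})} \<rparr>"

text \<open>
  Connected components are the maximal connected subgraphs. The empty graph is not connected in the
  library, so the graph without vertices (the case of the trivial group) has no components.
  The name \<open>connected\<close> is qualified because it also denotes the topological notion.
\<close>

definition num_components :: "'a pair_pre_digraph \<Rightarrow> nat" where
  "num_components \<Gamma> =
    card {H. pre_digraph.max_subgraph (with_proj \<Gamma>) Digraph_Component.connected H}"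

definition cyclic_subgroup :: "'a set \<Rightarrow> ('a, 'b) monoid_scheme \<Rightarrow> bool" where
  "cyclic_subgroup H G \<longleftrightarrow> subgroup H G \<and> cyclic_group (G\<lparr>carrier := H\<rparr>)"

definition maximal_cyclic_subgroup :: "'a set \<Rightarrow> ('a, 'b) monoid_scheme \<Rightarrow> bool" where
  "maximal_cyclic_subgroup H G \<longleftrightarrow>
    cyclic_subgroup H G \<and> \<not> (\<exists>K. cyclic_subgroup K G \<and> H \<subset> K)"

text \<open>
  The coefficient \<open>r\<^sub>p\<close>. The library's \<open>integer_mod_group 0\<close> is the infinite group of integers, so
  \<open>n = 0\<close> does not contribute to the first case when \<open>G\<close> is finite.
\<close>

definition r_coeff :: "('a, 'b) monoid_scheme \<Rightarrow> nat \<Rightarrow> nat" where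
  "r_coeff G p =
    (if \<exists>n. n \<noteq> p \<and> G \<cong> integer_mod_group n then 0
     else if G \<cong> integer_mod_group p then 1
     else card {H. maximal_cyclic_subgroup H G \<and> card H = p})"

end

theory Submission
  imports Defs
begin

text \<open>
  The two graphs have the same vertices, and the arcs of \<open>\<P>\<^sup>*(G)\<close> missing from \<open>\<R>\<P>\<^sup>*(G)\<close> join
  exactly the distinct generators of a common cyclic subgroup. Such twins have the same neighbours
  in \<open>\<R>\<P>\<^sup>*(G)\<close>, so as soon as one of them has a neighbour there, both lie in one component of
  \<open>\<R>\<P>\<^sup>*(G)\<close> anyway. Hence the components of the two graphs agree away from the isolated vertices
  of \<open>\<R>\<P>\<^sup>*(G)\<close> (\<open>rtrancl_eq_of_twins\<close>).

  A vertex \<open>v\<close> is isolated in \<open>\<R>\<P>\<^sup>*(G)\<close> iff \<open>\<langle>v\<rangle>\<close> is a maximal cyclic subgroup of prime order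
  (\<open>isolated_iff\<close>). If \<open>H\<close> is such a subgroup, of order \<open>p\<close>, then \<open>H - {\<one>}\<close> is a single component
  of \<open>\<P>\<^sup>*(G)\<close> and splits into \<open>p - 1\<close> singleton components of \<open>\<R>\<P>\<^sup>*(G)\<close>, so \<open>H\<close> contributes
  \<open>p - 2\<close> to the difference. Finally \<open>r\<^sub>p\<close> is in all cases the number of maximal cyclic subgroups of
  order \<open>p\<close>, because a cyclic group is its own only maximal cyclic subgroup
  (\<open>r_coeff_eq_card\<close>).
\<close>

section \<open>Components of symmetric graphs as reachability classes\<close>

text \<open>
  A connected subgraph stays connected when it is enlarged to the subgraph induced on its vertices,
  and an induced subgraph of a symmetric digraph is again symmetric, so that its connectedness is
  strong connectedness.
\<close>

lemma (in sym_digraph) max_connected_iff_max_strongly_connected: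
  "max_subgraph Digraph_Component.connected H \<longleftrightarrow> max_subgraph strongly_connected H"
proof -
  have conn: "strongly_connected K" if "induced_subgraph K G" "Digraph_Component.connected K" for K
    using that by (meson induced_graph_imp_graph sym_digraph.axioms(1) sym_digraph.sym_arcs
        wf_digraph.symmetric_connected_imp_strongly_connected)
  have sconn: "Digraph_Component.connected K" if "subgraph K G" "strongly_connected K" for K
  proof -
    interpret K: wf_digraph K using that(1) by (simp add: subgraph_def)
    show ?thesis using that(2)
      by (intro K.connectedI)
        (auto simp: strongly_connected_def intro: K.reachable_mk_symmetricI)
  qed
  have mono: "arc_mono Digraph_Component.connected"
    unfolding arc_mono_def
    by (metis spanning_def subgraph_def wf_digraph.connected_spanning_imp_connected)
  show ?thesis
  proof
    assume max: "max_subgraph Digraph_Component.connected H"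
    then have H: "induced_subgraph H G" using mono by (rule induced_subgraphI_arc_mono)
    show "max_subgraph strongly_connected H"
      using max conn[OF H] sconn by (auto simp: max_subgraph_def)
  next
    assume max: "max_subgraph strongly_connected H"
    then have H: "subgraph H G" "strongly_connected H" by (auto simp: max_subgraph_def)
    show "max_subgraph Digraph_Component.connected H"
    proof (rule max_subgraphI)
      show "Digraph_Component.connected H" "subgraph H G" using H sconn by auto
      fix K assume K: "H \<noteq> K" "subgraph H K" "subgraph K G"
      show "\<not> Digraph_Component.connected K"
      proof
        assume "Digraph_Component.connected K"
        let ?K = "G \<restriction> verts K"
        have ind: "induced_subgraph ?K G" using K(3) by auto
        have KK: "subgraph K ?K" using K(3)
          by (intro subgraph_induce_subgraphI2) auto
        then have "Digraph_Component.connected ?K"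
          using mono \<open>Digraph_Component.connected K\<close>
          unfolding arc_mono_def by (metis induce_subgraph_verts)
        then have "strongly_connected ?K" using conn ind by blast
        moreover have "subgraph H ?K" using K(2) KK subgraph_trans by blast
        ultimately have "?K = H"
          using max ind by (auto simp: max_subgraph_def)
        then have "H = K" using K(2) KK
          by (auto simp: subgraph_def compatible_def intro: pre_digraph.equality)
        with K(1) show False ..
      qed
    qed
  qed
qed

lemma num_components_eq_card_classes:
  assumes "sym (parcs \<Gamma>)" "parcs \<Gamma> \<subseteq> pverts \<Gamma> \<times> pverts \<Gamma>"
  shows "num_components \<Gamma> = card ((\<lambda>u. (parcs \<Gamma>)\<^sup>* `` {u}) ` pverts \<Gamma>)"
proof -
  interpret pair_sym_digraph \<Gamma>
    using assms by unfold_locales (auto simp: symmetric_def)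
  have "num_components \<Gamma> = card sccs"
    by (simp add: num_components_def sccs_altdef2 max_connected_iff_max_strongly_connected)
  also have "\<dots> = card (scc_of ` pverts \<Gamma>)"
    by (simp flip: card_sccs_verts sccs_verts_conv_scc_of)
  also have "scc_of ` pverts \<Gamma> = (\<lambda>u. (parcs \<Gamma>)\<^sup>* `` {u}) ` pverts \<Gamma>"
  proof (rule image_cong[OF refl])
    fix u assume u: "u \<in> pverts \<Gamma>"
    have "v \<in> pverts \<Gamma>" if "(u, v) \<in> (parcs \<Gamma>)\<^sup>*" for v
      using that u assms(2) by induction auto
    then have "{v. u \<rightarrow>\<^sup>*\<^bsub>with_proj \<Gamma>\<^esub> v} = (parcs \<Gamma>)\<^sup>* `` {u}"
      using u by (auto simp: reachable_conv)
    moreover have "scc_of u = {v. u \<rightarrow>\<^sup>*\<^bsub>with_proj \<Gamma>\<^esub> v}"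
      unfolding scc_of_def using symmetric_reachable' by blast
    ultimately show "scc_of u = (parcs \<Gamma>)\<^sup>* `` {u}" by simp
  qed
  finally show ?thesis .
qed

text \<open>
  Adding arcs between twins, that is, between vertices with the same neighbours, does not enlarge
  the component of a vertex that has a neighbour.
\<close>

lemma rtrancl_eq_of_twins:
  assumes sub: "E \<subseteq> E'" and "sym E"
    and twins: "\<And>u v. (u, v) \<in> E' \<Longrightarrow> (u, v) \<in> E \<or> E `` {u} = E `` {v}"
    and u: "E `` {u} \<noteq> {}"
  shows "E'\<^sup>* `` {u} = E\<^sup>* `` {u}"
proof
  have "(u, v) \<in> E\<^sup>* \<and> E `` {v} \<noteq> {}" if "(u, v) \<in> E'\<^sup>*" for v
    using that
  proof induction
    case (step v w)
    then obtain x where x: "(v, x) \<in> E" by auto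
    show ?case
    proof (cases "(v, w) \<in> E")
      case True
      then show ?thesis using step \<open>sym E\<close> by (auto dest: symD intro: rtrancl.rtrancl_into_rtrancl)
    next
      case False
      then have "(w, x) \<in> E" using twins[OF step(2)] x by auto
      then have "(x, w) \<in> E" using \<open>sym E\<close> by (auto dest: symD)
      then have "(u, w) \<in> E\<^sup>*" using step.IH x by (meson rtrancl.rtrancl_into_rtrancl)
      then show ?thesis using \<open>(w, x) \<in> E\<close> by auto
    qed
  qed (use u in auto)
  then show "E'\<^sup>* `` {u} \<subseteq> E\<^sup>* `` {u}" by auto
  show "E\<^sup>* `` {u} \<subseteq> E'\<^sup>* `` {u}" using rtrancl_mono[OF sub] by auto
qed

section \<open>Maximal cyclic subgroups\<close>

lemma cyclic_integer_mod_group: "cyclic_group (integer_mod_group n)"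
proof -
  \<comment> \<open>The generator \<open>1\<close> is reduced modulo \<open>n\<close> because of \<open>n = 1\<close>, where the only element is \<open>0\<close>.\<close>
  have "1 mod int n \<in> carrier (integer_mod_group n)"
    by (simp add: carrier_integer_mod_group)
  moreover have "carrier (integer_mod_group n) =
      range (\<lambda>k::int. (1 mod int n) [^]\<^bsub>integer_mod_group n\<^esub> k)"
  proof -
    have "k \<in> range (\<lambda>k::int. k mod int n)" if "0 \<le> k" "k < int n" for k
      using that by (intro image_eqI[of _ _ k]) auto
    then show ?thesis
      by (auto simp: carrier_integer_mod_group int_pow_integer_mod_group mod_mult_right_eq)
  qed
  ultimately show ?thesis
    unfolding group.cyclic_group[OF group_integer_mod_group] by (rule rev_bexI)
qed

context group
begin

lemma generate_singleton_subset_iff: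
  assumes "u \<in> carrier G" "v \<in> carrier G"
  shows "generate G {v} \<subseteq> generate G {u} \<longleftrightarrow> v \<in> generate G {u}"
  using assms generate_subgroup_incl[of "{v}" "generate G {u}"] generate_is_subgroup[of "{u}"]
  by (auto intro: generate.incl)

lemma cyclic_subgroup_iff:
  "cyclic_subgroup H G \<longleftrightarrow> (\<exists>u \<in> carrier G. H = generate G {u})"
proof
  assume H: "cyclic_subgroup H G"
  then have sub: "subgroup H G" and "cyclic_group (G\<lparr>carrier := H\<rparr>)"
    by (auto simp: cyclic_subgroup_def)
  then obtain x where x: "x \<in> H" "subgroup_generated (G\<lparr>carrier := H\<rparr>) {x} = G\<lparr>carrier := H\<rparr>"
    by (auto simp: cyclic_group_def)
  then have "generate (G\<lparr>carrier := H\<rparr>) {x} = H"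
    using carrier_subgroup_generated[of "G\<lparr>carrier := H\<rparr>" "{x}"] by simp
  then have "H = generate G {x}" using generate_consistent[of "{x}" H] x(1) sub by simp
  then show "\<exists>u \<in> carrier G. H = generate G {u}" using x(1) sub subgroup.subset by blast
next
  assume "\<exists>u \<in> carrier G. H = generate G {u}"
  then obtain u where u: "u \<in> carrier G" "H = generate G {u}" by auto
  have "G\<lparr>carrier := H\<rparr> = subgroup_generated G {u}"
    using u by (simp add: subgroup_generated_def)
  then show "cyclic_subgroup H G"
    using u cyclic_group_generated[of u] by (simp add: cyclic_subgroup_def generate_is_subgroup)
qed

lemma maximal_cyclic_subgroup_generate_iff:
  assumes "v \<in> carrier G"
  shows "maximal_cyclic_subgroup (generate G {v}) G \<longleftrightarrow>
    (\<forall>w \<in> carrier G. \<not> generate G {v} \<subset> generate G {w})"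
  using assms by (auto simp: maximal_cyclic_subgroup_def cyclic_subgroup_iff)

lemma maximal_cyclic_subgroup_of_cyclic:
  assumes "cyclic_group G"
  shows "maximal_cyclic_subgroup H G \<longleftrightarrow> H = carrier G"
proof -
  have "cyclic_subgroup (carrier G) G"
    using assms by (simp add: cyclic_subgroup_def subgroup_self)
  moreover have "K \<subseteq> carrier G" if "cyclic_subgroup K G" for K
    using that by (simp add: cyclic_subgroup_def subgroup.subset)
  ultimately show ?thesis
    by (meson maximal_cyclic_subgroup_def psubsetI psubset_subset_trans less_irrefl)
qed

lemma r_coeff_eq_card: "r_coeff G p = card {H. maximal_cyclic_subgroup H G \<and> card H = p}"
proof (cases "\<exists>n. G \<cong> integer_mod_group n")
  case False
  then show ?thesis by (auto simp: r_coeff_def)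
next
  case True
  then obtain n where n: "G \<cong> integer_mod_group n" by blast
  \<comment> \<open>This includes \<open>k = 0\<close>: the integers are infinite, and \<open>card\<close> is \<open>0\<close> on infinite sets.\<close>
  have card_G: "card (carrier G) = k" if "G \<cong> integer_mod_group k" for k
    using iso_same_card[OF that] by (simp add: carrier_integer_mod_group)
  have "cyclic_group G"
    using isomorphic_group_cyclicity[OF n] by (simp add: cyclic_integer_mod_group)
  then have "{H. maximal_cyclic_subgroup H G \<and> card H = p} = (if n = p then {carrier G} else {})"
    using card_G[OF n] by (auto simp: maximal_cyclic_subgroup_of_cyclic)
  then show ?thesis using n card_G by (auto simp: r_coeff_def)
qed

text \<open>
  For a proper divisor \<open>k > 1\<close> of the order of \<open>u\<close>, the power \<open>u\<^sup>k\<close> generates a nontrivial proper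
  subgroup of \<open>\<langle>u\<rangle>\<close>; this is why a cyclic group without such subgroups has prime order.
\<close>

lemma prime_card_generate_iff:
  assumes fin: "finite (carrier G)" and u: "u \<in> carrier G" "u \<noteq> \<one>"
  shows "Factorial_Ring.prime (card (generate G {u})) \<longleftrightarrow>
    (\<forall>w \<in> carrier G - {\<one>}. \<not> generate G {w} \<subset> generate G {u})"
proof
  assume p: "Factorial_Ring.prime (card (generate G {u}))"
  show "\<forall>w \<in> carrier G - {\<one>}. \<not> generate G {w} \<subset> generate G {u}"
  proof (intro ballI notI)
    fix w assume w: "w \<in> carrier G - {\<one>}" and sub: "generate G {w} \<subset> generate G {u}"
    then have "w \<in> generate G {u}" using generate_singleton_subset_iff u by blast
    then obtain k :: nat where k: "w = u [^] k"
      using generate_pow_on_finite_carrier[OF fin u(1)] by auto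
    have "ord w dvd ord u"
      using w u by (simp add: k ord_pow_gen)
        (metis dvd_div_mult_self dvd_triv_left gcd_dvd1)
    moreover have "ord w \<noteq> 1" using w ord_eq_1 by auto
    ultimately have "ord w = ord u"
      using p generate_pow_card[OF u(1)] by (auto simp: prime_nat_iff)
    moreover have "finite (generate G {u})"
      using generate_incl[of "{u}"] u(1) fin finite_subset by auto
    then have "card (generate G {w}) < card (generate G {u})"
      using sub by (rule psubset_card_mono)
    ultimately show False using generate_pow_card u w by auto
  qed
next
  assume min: "\<forall>w \<in> carrier G - {\<one>}. \<not> generate G {w} \<subset> generate G {u}"
  have "ord u \<ge> 1" using ord_ge_1[OF fin u(1)] .
  moreover have "ord u \<noteq> 1" using u ord_eq_1 by auto
  ultimately have "ord u > 1" by simp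
  moreover have "k = 1 \<or> k = ord u" if k: "k dvd ord u" for k
  proof -
    have k0: "k \<noteq> 0" using k \<open>ord u > 1\<close> by (metis dvd_0_left_iff not_one_less_zero)
    let ?w = "u [^] k"
    have ord_w: "ord ?w = ord u div k" using ord_pow[OF u(1) k k0] .
    show ?thesis
    proof (cases "?w = \<one>")
      case True
      then have "ord u dvd k" using u(1) by (simp add: pow_eq_id)
      then show ?thesis using k by (simp add: dvd_antisym)
    next
      case False
      have "generate G {?w} \<subseteq> generate G {u}"
        using u(1) generate_pow_on_finite_carrier[OF fin u(1)]
        by (subst generate_singleton_subset_iff) auto
      then have "generate G {?w} = generate G {u}" using min False u(1) by auto
      then have "ord u div k = ord u" using ord_w generate_pow_card u(1) by auto
      then show ?thesis using k0 \<open>ord u > 1\<close> by (simp add: div_eq_dividend_iff)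
    qed
  qed
  ultimately have "Factorial_Ring.prime (ord u)" by (auto simp: prime_nat_iff)
  then show "Factorial_Ring.prime (card (generate G {u}))" using generate_pow_card[OF u(1)] by simp
qed

lemma isolated_iff:
  assumes "finite (carrier G)" "v \<in> carrier G" "v \<noteq> \<one>"
  shows "parcs (proper_reduced_power_graph G) `` {v} = {} \<longleftrightarrow>
    maximal_cyclic_subgroup (generate G {v}) G \<and> Factorial_Ring.prime (card (generate G {v}))"
proof -
  \<comment> \<open>Since \<open>\<langle>\<one>\<rangle>\<close> is trivial, maximality may be tested on the vertices \<open>w \<noteq> \<one>\<close> alone.\<close>
  have "\<not> generate G {v} \<subset> generate G {\<one>}"
    using generate_one generate.one[of G "{v}"] by auto
  then have "maximal_cyclic_subgroup (generate G {v}) G \<longleftrightarrow>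
      (\<forall>w \<in> carrier G - {\<one>}. \<not> generate G {v} \<subset> generate G {w})"
    using assms(2) by (auto simp: maximal_cyclic_subgroup_generate_iff)
  then show ?thesis
    unfolding prime_card_generate_iff[OF assms]
    using assms(2,3) by (auto simp: proper_reduced_power_graph_def)
qed

section \<open>Comparison of the two graphs\<close>

lemma num_components_diff:
  assumes fin: "finite (carrier G)"
  defines "M \<equiv> {H. maximal_cyclic_subgroup H G \<and> Factorial_Ring.prime (card H)}"
  shows "int (num_components (proper_reduced_power_graph G)) =
    int (num_components (proper_power_graph G)) + (\<Sum>H\<in>M. int (card H) - 2)"
proof -
  define V where "V = carrier G - {\<one>}"
  define E where "E = parcs (proper_power_graph G)"
  define F where "F = parcs (proper_reduced_power_graph G)"
  define I where "I = {v \<in> V. F `` {v} = {}}"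
  have E: "(u, v) \<in> E \<longleftrightarrow> u \<in> V \<and> v \<in> V \<and> u \<noteq> v \<and>
      (generate G {v} \<subseteq> generate G {u} \<or> generate G {u} \<subseteq> generate G {v})" for u v
    by (auto simp: E_def V_def proper_power_graph_def)
  have F: "(u, v) \<in> F \<longleftrightarrow> u \<in> V \<and> v \<in> V \<and>
      (generate G {v} \<subset> generate G {u} \<or> generate G {u} \<subset> generate G {v})" for u v
    by (auto simp: F_def V_def proper_reduced_power_graph_def)
  have "finite V" using fin by (simp add: V_def)
  have "sym E" "sym F" by (auto simp: sym_def E F)
  have E_comps: "num_components (proper_power_graph G) = card ((\<lambda>u. E\<^sup>* `` {u}) ` V)"
    using num_components_eq_card_classes[of "proper_power_graph G"] \<open>sym E\<close>
    by (auto simp: E_def V_def proper_power_graph_def)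
  have F_comps: "num_components (proper_reduced_power_graph G) = card ((\<lambda>u. F\<^sup>* `` {u}) ` V)"
    using num_components_eq_card_classes[of "proper_reduced_power_graph G"] \<open>sym F\<close>
    by (auto simp: F_def V_def proper_reduced_power_graph_def)

  have I_iff: "v \<in> I \<longleftrightarrow> v \<in> V \<and> generate G {v} \<in> M" for v
    using isolated_iff[OF fin] by (auto simp: I_def F_def M_def V_def)
  have gen_eq: "generate G {w} = generate G {v}" if "v \<in> I" "w \<in> generate G {v} - {\<one>}" for v w
  proof -
    have "v \<in> carrier G" using that(1) by (auto simp: I_def V_def)
    then have w: "w \<in> V" using that(2) generate_incl[of "{v}"] by (auto simp: V_def)
    then have "generate G {w} \<subseteq> generate G {v}"
      using generate_singleton_subset_iff \<open>v \<in> carrier G\<close> that(2) by (auto simp: V_def)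
    moreover have "(v, w) \<notin> F" using that(1) by (auto simp: I_def)
    ultimately show ?thesis using F w that(1) by (auto simp: I_def)
  qed
  have I_gen: "w \<in> I" if "v \<in> I" "w \<in> generate G {v} - {\<one>}" for v w
    using gen_eq[OF that] that generate_in_carrier[of "{v}" w] by (auto simp: I_iff V_def)
  have M_gen: "\<exists>v \<in> I. H = generate G {v}" if H: "H \<in> M" for H
  proof -
    obtain v where v: "v \<in> carrier G" "H = generate G {v}"
      using H by (auto simp: M_def maximal_cyclic_subgroup_def cyclic_subgroup_iff)
    have "v \<noteq> \<one>" using H v(2) generate_one by (auto simp: M_def)
    then show ?thesis using H v by (auto simp: I_iff V_def)
  qed

  \<comment> \<open>Away from the isolated vertices the classes agree.\<close>
  have twins: "(u, v) \<in> F \<or> F `` {u} = F `` {v}" if "(u, v) \<in> E" for u v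
  proof (cases "generate G {u} = generate G {v}")
    case True
    then show ?thesis using that by (auto simp: E F)
  next
    case False
    then show ?thesis using that by (auto simp: E F)
  qed
  have "F \<subseteq> E" by (auto simp: E F)
  then have same: "E\<^sup>* `` {u} = F\<^sup>* `` {u}" if "u \<in> V - I" for u
    using that rtrancl_eq_of_twins[OF _ \<open>sym F\<close> twins] by (auto simp: I_def)

  \<comment> \<open>The class of an isolated vertex in either graph.\<close>
  have E_class: "E\<^sup>* `` {v} = generate G {v} - {\<one>}" if v: "v \<in> I" for v
  proof
    have vV: "v \<in> V" using v by (simp add: I_def)
    have "w \<in> generate G {v} - {\<one>}" if "(v, w) \<in> E\<^sup>*" for w
      using that
    proof induction
      case base
      show ?case using vV by (auto simp: V_def intro: generate.incl)
    next
      case (step w x)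
      then have "generate G {w} = generate G {v}" by (intro gen_eq[OF v])
      moreover have "(v, x) \<notin> F" using v by (auto simp: I_def)
      ultimately have "generate G {x} = generate G {v}" using step(2) vV by (auto simp: E F)
      then show ?case using step(2) generate.incl[of x "{x}" G] by (auto simp: E V_def)
    qed
    then show "E\<^sup>* `` {v} \<subseteq> generate G {v} - {\<one>}" by auto
    show "generate G {v} - {\<one>} \<subseteq> E\<^sup>* `` {v}"
    proof
      fix w assume w: "w \<in> generate G {v} - {\<one>}"
      then have "w \<in> V" using I_gen[OF v] by (simp add: I_def)
      then show "w \<in> E\<^sup>* `` {v}" using gen_eq[OF v w] vV by (cases "w = v") (auto simp: E)
    qed
  qed
  have F_class: "F\<^sup>* `` {v} = {v}" if "v \<in> I" for v
  proof -
    have "w = v" if "(v, w) \<in> F\<^sup>*" for w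
      using that \<open>v \<in> I\<close> by (auto simp: I_def elim: converse_rtranclE)
    then show ?thesis by auto
  qed

  \<comment> \<open>The components common to both graphs, those without isolated vertices of \<open>\<R>\<P>\<^sup>*(G)\<close>.\<close>
  define C where "C = (\<lambda>u. F\<^sup>* `` {u}) ` (V - I)"
  have "finite C" using \<open>finite V\<close> by (simp add: C_def)
  have "I \<subseteq> V" by (auto simp: I_def)
  then have V_split: "V = (V - I) \<union> I" by auto
  have "finite I" using \<open>I \<subseteq> V\<close> \<open>finite V\<close> finite_subset by blast
  have "M \<subseteq> (\<lambda>v. generate G {v}) ` I" using M_gen by auto
  then have "finite M" using \<open>finite I\<close> finite_surj by blast
  have one_in: "\<one> \<in> H" if "H \<in> M" for H using M_gen[OF that] generate.one by auto

  have E_split: "(\<lambda>u. E\<^sup>* `` {u}) ` V = C \<union> (\<lambda>H. H - {\<one>}) ` M"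
  proof -
    have "(\<lambda>u. E\<^sup>* `` {u}) ` I = (\<lambda>H. H - {\<one>}) ` M"
      using M_gen by (force simp: E_class I_iff)
    moreover have "(\<lambda>u. E\<^sup>* `` {u}) ` (V - I) = C" using same by (simp add: C_def)
    ultimately show ?thesis by (subst V_split) (simp only: image_Un)
  qed
  have "C \<inter> (\<lambda>H. H - {\<one>}) ` M = {}"
  proof -
    have "u \<in> I" if "u \<in> V" "H \<in> M" "F\<^sup>* `` {u} = H - {\<one>}" for u H
      using M_gen[OF that(2)] I_gen that(3) by blast
    then show ?thesis by (auto simp: C_def)
  qed
  moreover have "inj_on (\<lambda>H. H - {\<one>}) M" using one_in by (intro inj_onI) blast
  ultimately have E_card: "card ((\<lambda>u. E\<^sup>* `` {u}) ` V) = card C + card M"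
    unfolding E_split using \<open>finite C\<close> \<open>finite M\<close> by (simp add: card_Un_disjoint card_image)

  have F_split: "(\<lambda>u. F\<^sup>* `` {u}) ` V = C \<union> (\<lambda>v. {v}) ` I"
  proof -
    have "(\<lambda>u. F\<^sup>* `` {u}) ` I = (\<lambda>v. {v}) ` I" using F_class by auto
    moreover have "(\<lambda>u. F\<^sup>* `` {u}) ` (V - I) = C" by (simp add: C_def)
    ultimately show ?thesis by (subst V_split) (simp only: image_Un)
  qed
  have "C \<inter> (\<lambda>v. {v}) ` I = {}"
  proof -
    have "u = v" if "F\<^sup>* `` {u} = {v}" for u v using that by blast
    then show ?thesis by (auto simp: C_def)
  qed
  then have F_card: "card ((\<lambda>u. F\<^sup>* `` {u}) ` V) = card C + card I"
    unfolding F_split using \<open>finite C\<close> \<open>finite I\<close> by (simp add: card_Un_disjoint card_image)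

  have fin_M: "finite H" if "H \<in> M" for H
    using that by (auto simp: M_def intro: card_ge_0_finite prime_gt_0_nat)
  have I_Un: "I = (\<Union>H\<in>M. H - {\<one>})"
  proof
    show "I \<subseteq> (\<Union>H\<in>M. H - {\<one>})"
    proof
      fix v assume "v \<in> I"
      then have "generate G {v} \<in> M" "v \<in> generate G {v} - {\<one>}"
        by (auto simp: I_iff V_def intro: generate.incl)
      then show "v \<in> (\<Union>H\<in>M. H - {\<one>})" by blast
    qed
    show "(\<Union>H\<in>M. H - {\<one>}) \<subseteq> I" using M_gen I_gen by blast
  qed
  have "(H - {\<one>}) \<inter> (K - {\<one>}) = {}" if "H \<in> M" "K \<in> M" "H \<noteq> K" for H K
  proof -
    have "generate G {x} = L" if "L \<in> M" "x \<in> L - {\<one>}" for x L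
      using M_gen[OF that(1)] gen_eq that(2) by blast
    then show ?thesis using that by blast
  qed
  then have "card I = (\<Sum>H\<in>M. card (H - {\<one>}))"
    unfolding I_Un using \<open>finite M\<close> fin_M by (intro card_UN_disjoint) simp_all
  then have "int (card I) = (\<Sum>H\<in>M. int (card (H - {\<one>})))" by simp
  also have "\<dots> = (\<Sum>H\<in>M. int (card H) - 1)"
  proof (rule sum.cong[OF refl])
    fix H assume H: "H \<in> M"
    have "Suc (card (H - {\<one>})) = card H" using card_Suc_Diff1[OF fin_M[OF H] one_in[OF H]] .
    then show "int (card (H - {\<one>})) = int (card H) - 1" by linarith
  qed
  also have "\<dots> = int (card M) + (\<Sum>H\<in>M. int (card H) - 2)"
    by (simp add: sum_subtractf)
  finally show ?thesis by (simp add: E_comps F_comps E_card F_card)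
qed

end

theorem theorem6p1:
  fixes G :: "('a, 'b) monoid_scheme"
  assumes "group G" and "finite (carrier G)"
  shows "int (num_components (proper_reduced_power_graph G)) =
    int (num_components (proper_power_graph G)) +
    (\<Sum>p | Factorial_Ring.prime p \<and> p dvd order G. int (r_coeff G p) * (int p - 2))"
proof -
  interpret group G by fact
  define M where "M = {H. maximal_cyclic_subgroup H G \<and> Factorial_Ring.prime (card H)}"
  define P where "P = {p. Factorial_Ring.prime p \<and> p dvd order G}"
  have "order G > 0" using assms(2) by (simp add: order_gt_0_iff_finite)
  then have "finite P" by (auto simp: P_def)
  have M_sub: "subgroup H G" if "H \<in> M" for H
    using that by (simp add: M_def maximal_cyclic_subgroup_def cyclic_subgroup_def)
  then have "M \<subseteq> Pow (carrier G)" using subgroup.subset by blast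
  then have "finite M" using assms(2) finite_subset by blast
  have "card H dvd order G" if "H \<in> M" for H
    using lagrange[OF M_sub[OF that]] by (metis dvd_triv_right)
  then have "card ` M \<subseteq> P" by (auto simp: P_def M_def)
  then have "(\<Sum>H\<in>M. int (card H) - 2) = (\<Sum>p\<in>P. \<Sum>H | H \<in> M \<and> card H = p. int (card H) - 2)"
    using sum.group[OF \<open>finite M\<close> \<open>finite P\<close>, of card "\<lambda>H. int (card H) - 2"] by simp
  also have "\<dots> = (\<Sum>p\<in>P. int (r_coeff G p) * (int p - 2))"
  proof (rule sum.cong[OF refl])
    fix p assume "p \<in> P"
    then have "{H \<in> M. card H = p} = {H. maximal_cyclic_subgroup H G \<and> card H = p}"
      by (auto simp: M_def P_def)
    then show "(\<Sum>H | H \<in> M \<and> card H = p. int (card H) - 2) = int (r_coeff G p) * (int p - 2)"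
      by (simp add: r_coeff_eq_card)
  qed
  finally show ?thesis
    using num_components_diff[OF assms(2)] by (simp add: M_def P_def)
qed

end
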